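(* Let $(N,\mu_0)$ be a perpetual free-choice system. Then $(N,\mu_0)$ is lucent: for any two markings $\mu_1,\mu_2$ reachable in $(N,\mu_0)$, $$en(N,\mu_1)=en(N,\mu_2)\implies \mu_1=\mu_2.$$
   Context: A net $N=(P,T,F)$ is a finite directed bipartite graph: $P$ (places) and $T$ (transitions) are disjoint finite sets and $F\subset (P\times T)\cup(T\times P)$. Nets are assumed weakly connected. For a node $x$, ${}^\bullet x=\{y:(y,x)\in F\}$ and $x^\bullet=\{y:(x,y)\in F\}$. $N$ is a free-choice net if for every $(p,t)\in F\cap(P\times T)$ one has ${}^\bullet t\times p^\bullet\subset F$. The cluster of a node $x$ is the smallest subnet containing $x$ which, with each of its places $p$, contains $p^\bullet$ and, with each of its transitions $t$, contains ${}^\bullet t$. A marking is a map $\mu:P\to\mathbb{N}$; a transition $t$ is enabled at $\mu$ if $\mu(p)\ge 1$ for all $p\in{}^\bullet t$; firing $t$ removes one token from each place of ${}^\bullet t$ and adds one token to each place of $t^\bullet$. $en(N,\mu)$ denotes the set of transitions enabled at $\mu$. A marking is reachable in $(N,\mu_0)$ if it arises from $\mu_0$ by firing a finite sequence of successively enabled transitions. A home marking is a marking reachable from every reachable marking. $(N,\mu_0)$ is live if from every reachable marking, for every transition $t$, some marking enabling $t$ is reachable; it is bounded if there is $K$ with $\mu(p)\le K$ for all reachable $\mu$ and all places $p$. A free-choice system is a pair $(N,\mu_0)$ with $N$ a free-choice net. For a cluster $cl$, $\mu_{cl}$ is the marking with $\mu_{cl}(p)=1$ if $p$ is a place of $cl$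 and $0$ otherwise. $(N,\mu_0)$ is perpetual if it is live and bounded and there is a cluster $cl$ such that $\mu_{cl}$ is a home marking of $(N,\mu_0)$. *)

theory Defs
  imports Main
begin

text \<open>A net N = (P,T,F). Places have type 'p, transitions type 't (so P and T are
disjoint by construction); the flow relation F is split into its part in P x T
(arcs place -> transition) and its part in T x P (arcs transition -> place).\<close>

record ('p, 't) net =
  places :: "'p set"
  trans  :: "'t set"
  arcsPT :: "('p \<times> 't) set"
  arcsTP :: "('t \<times> 'p) set"

text \<open>Nodes of the net (disjoint union of places and transitions).\<close>
type_synonym ('p, 't) node = "'p + 't"

definition nodes :: "('p, 't) net \<Rightarrow> ('p, 't) node set" where
  "nodes N = Inl ` places N \<union> Inr ` trans N"

text \<open>The flow relation F as a relation on nodes.\<close>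
definition flow :: "('p, 't) net \<Rightarrow> (('p, 't) node \<times> ('p, 't) node) set" where
  "flow N = {(Inl p, Inr t) | p t. (p, t) \<in> arcsPT N} \<union>
            {(Inr t, Inl p) | t p. (t, p) \<in> arcsTP N}"

text \<open>Weakly connected: any two nodes are connected by a path in the underlying
undirected graph.\<close>
definition weakly_connected :: "('p, 't) net \<Rightarrow> bool" where
  "weakly_connected N \<longleftrightarrow>
     (\<forall>x\<in>nodes N. \<forall>y\<in>nodes N. (x, y) \<in> (flow N \<union> (flow N)\<inverse>)\<^sup>*)"

definition is_net :: "('p, 't) net \<Rightarrow> bool" where
  "is_net N \<longleftrightarrow> finite (places N) \<and> finite (trans N)
     \<and> arcsPT N \<subseteq> places N \<times> trans N \<and> arcsTP N \<subseteq> trans N \<times> places N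
     \<and> weakly_connected N"

text \<open>Presets and postsets.\<close>
definition preT :: "('p, 't) net \<Rightarrow> 't \<Rightarrow> 'p set" where
  "preT N t = {p. (p, t) \<in> arcsPT N}"
definition postT :: "('p, 't) net \<Rightarrow> 't \<Rightarrow> 'p set" where
  "postT N t = {p. (t, p) \<in> arcsTP N}"
definition preP :: "('p, 't) net \<Rightarrow> 'p \<Rightarrow> 't set" where
  "preP N p = {t. (t, p) \<in> arcsTP N}"
definition postP :: "('p, 't) net \<Rightarrow> 'p \<Rightarrow> 't set" where
  "postP N p = {t. (p, t) \<in> arcsPT N}"

definition free_choice :: "('p, 't) net \<Rightarrow> bool" where
  "free_choice N \<longleftrightarrow> is_net N \<and>
     (\<forall>p t. (p, t) \<in> arcsPT N \<longrightarrow> preT N t \<times> postP N p \<subseteq> arcsPT N)"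

text \<open>Cluster of a node x: the smallest set of nodes containing x which contains the postset of p
with each of its places p and the preset of t with each of its transitions t (the subnet
being the induced one).\<close>
inductive_set cluster :: "('p, 't) net \<Rightarrow> ('p, 't) node \<Rightarrow> ('p, 't) node set"
  for N x where
  base: "x \<in> cluster N x"
| place_post: "Inl p \<in> cluster N x \<Longrightarrow> t \<in> postP N p \<Longrightarrow> Inr t \<in> cluster N x"
| trans_pre: "Inr t \<in> cluster N x \<Longrightarrow> p \<in> preT N t \<Longrightarrow> Inl p \<in> cluster N x"

definition is_cluster :: "('p, 't) net \<Rightarrow> ('p, 't) node set \<Rightarrow> bool" where
  "is_cluster N C \<longleftrightarrow> (\<exists>x\<in>nodes N. C = cluster N x)"

text \<open>Markings: maps P -> nat (represented as total functions that vanish outside P).\<close>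
definition marking :: "('p, 't) net \<Rightarrow> ('p \<Rightarrow> nat) \<Rightarrow> bool" where
  "marking N \<mu> \<longleftrightarrow> (\<forall>p. p \<notin> places N \<longrightarrow> \<mu> p = 0)"

definition enabled :: "('p, 't) net \<Rightarrow> ('p \<Rightarrow> nat) \<Rightarrow> 't \<Rightarrow> bool" where
  "enabled N \<mu> t \<longleftrightarrow> t \<in> trans N \<and> (\<forall>p\<in>preT N t. \<mu> p \<ge> 1)"

definition en :: "('p, 't) net \<Rightarrow> ('p \<Rightarrow> nat) \<Rightarrow> 't set" where
  "en N \<mu> = {t. enabled N \<mu> t}"

definition fire :: "('p, 't) net \<Rightarrow> ('p \<Rightarrow> nat) \<Rightarrow> 't \<Rightarrow> ('p \<Rightarrow> nat)" where
  "fire N \<mu> t = (\<lambda>p. \<mu> p - (if p \<in> preT N t then 1 else 0)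
                         + (if p \<in> postT N t then 1 else 0))"

text \<open>One-step relation and reachability (finite firing sequences).\<close>
definition step :: "('p, 't) net \<Rightarrow> (('p \<Rightarrow> nat) \<times> ('p \<Rightarrow> nat)) set" where
  "step N = {(\<mu>, fire N \<mu> t) | \<mu> t. enabled N \<mu> t}"

definition reachable :: "('p, 't) net \<Rightarrow> ('p \<Rightarrow> nat) \<Rightarrow> ('p \<Rightarrow> nat) \<Rightarrow> bool" where
  "reachable N \<mu>0 \<mu> \<longleftrightarrow> (\<mu>0, \<mu>) \<in> (step N)\<^sup>*"

definition home_marking :: "('p, 't) net \<Rightarrow> ('p \<Rightarrow> nat) \<Rightarrow> ('p \<Rightarrow> nat) \<Rightarrow> bool" where
  "home_marking N \<mu>0 \<mu>h \<longleftrightarrow> (\<forall>\<mu>. reachable N \<mu>0 \<mu> \<longrightarrow> reachable N \<mu> \<mu>h)"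

definition live :: "('p, 't) net \<Rightarrow> ('p \<Rightarrow> nat) \<Rightarrow> bool" where
  "live N \<mu>0 \<longleftrightarrow> (\<forall>\<mu>. reachable N \<mu>0 \<mu> \<longrightarrow>
     (\<forall>t\<in>trans N. \<exists>\<mu>'. reachable N \<mu> \<mu>' \<and> enabled N \<mu>' t))"

definition bounded :: "('p, 't) net \<Rightarrow> ('p \<Rightarrow> nat) \<Rightarrow> bool" where
  "bounded N \<mu>0 \<longleftrightarrow> (\<exists>K. \<forall>\<mu>. reachable N \<mu>0 \<mu> \<longrightarrow> (\<forall>p\<in>places N. \<mu> p \<le> K))"

definition cluster_marking :: "('p, 't) node set \<Rightarrow> ('p \<Rightarrow> nat)" where
  "cluster_marking C = (\<lambda>p. if Inl p \<in> C then 1 else 0)"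

definition perpetual :: "('p, 't) net \<Rightarrow> ('p \<Rightarrow> nat) \<Rightarrow> bool" where
  "perpetual N \<mu>0 \<longleftrightarrow> live N \<mu>0 \<and> bounded N \<mu>0 \<and>
     (\<exists>C. is_cluster N C \<and> home_marking N \<mu>0 (cluster_marking C))"

definition free_choice_system :: "('p, 't) net \<Rightarrow> ('p \<Rightarrow> nat) \<Rightarrow> bool" where
  "free_choice_system N \<mu>0 \<longleftrightarrow> free_choice N \<and> marking N \<mu>0"

definition lucent :: "('p, 't) net \<Rightarrow> ('p \<Rightarrow> nat) \<Rightarrow> bool" where
  "lucent N \<mu>0 \<longleftrightarrow> (\<forall>\<mu>1 \<mu>2. reachable N \<mu>0 \<mu>1 \<longrightarrow> reachable N \<mu>0 \<mu>2 \<longrightarrow>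
     en N \<mu>1 = en N \<mu>2 \<longrightarrow> \<mu>1 = \<mu>2)"

end

theory Submission
  imports Defs
begin

text \<open>Every place of a live and bounded free-choice net lies in a P-component, and since a P-component
meets each cluster in at most one place, the home marking of a cluster forces it to carry exactly one
token at every reachable marking. Hence the home marking is the only reachable marking enabling the
home cluster. Select in every other cluster one transition leading towards the home cluster. From any
reachable marking, firing only selected transitions ends in the home marking; on the way the token of
each P-component moves deterministically, so no transition fires twice. Which transitions fire is
determined by the initially enabled ones: exactly those that receive a token from them, directly or
indirectly. So two reachable markings enabling the same transitions reach the home marking with the
same number of firings of each transition, and by the marking equation they coincide.\<close>

section \<open>Firing sequences\<close>

fun fires :: "('p, 't) net \<Rightarrow> ('p \<Rightarrow> nat) \<Rightarrow> 't list \<Rightarrow> ('p \<Rightarrow> nat) \<Rightarrow> bool" where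
  "fires N \<mu> [] \<mu>' \<longleftrightarrow> \<mu>' = \<mu>"
| "fires N \<mu> (t # \<sigma>) \<mu>' \<longleftrightarrow> enabled N \<mu> t \<and> fires N (fire N \<mu> t) \<sigma> \<mu>'"

lemma fires_append:
  "fires N \<mu> (\<sigma> @ \<tau>) \<mu>' \<longleftrightarrow> (\<exists>\<nu>. fires N \<mu> \<sigma> \<nu> \<and> fires N \<nu> \<tau> \<mu>')"
  by (induction \<sigma> arbitrary: \<mu>) auto

lemma reachable_refl: "reachable N \<mu> \<mu>"
  by (simp add: reachable_def)

lemma reachable_trans: "reachable N \<mu> \<nu> \<Longrightarrow> reachable N \<nu> \<xi> \<Longrightarrow> reachable N \<mu> \<xi>"
  unfolding reachable_def by (rule rtrancl_trans)

lemma reachable_fire: "enabled N \<mu> t \<Longrightarrow> reachable N \<mu> (fire N \<mu> t)"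
  unfolding reachable_def step_def by (rule r_into_rtrancl) blast

lemma fires_imp_reachable: "fires N \<mu> \<sigma> \<mu>' \<Longrightarrow> reachable N \<mu> \<mu>'"
  by (induction \<sigma> arbitrary: \<mu>) (auto simp: reachable_refl intro: reachable_trans reachable_fire)

lemma reachable_iff_fires: "reachable N \<mu> \<mu>' \<longleftrightarrow> (\<exists>\<sigma>. fires N \<mu> \<sigma> \<mu>')"
proof
  assume "reachable N \<mu> \<mu>'"
  then have "(\<mu>, \<mu>') \<in> (step N)\<^sup>*"
    by (simp add: reachable_def)
  then show "\<exists>\<sigma>. fires N \<mu> \<sigma> \<mu>'"
  proof (induction rule: converse_rtrancl_induct)
    case base
    have "fires N \<mu>' [] \<mu>'" by simp
    then show ?case by blast
  next
    case (step \<mu> \<nu>)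
    then obtain t \<sigma> where "enabled N \<mu> t" "\<nu> = fire N \<mu> t" "fires N \<nu> \<sigma> \<mu>'"
      by (auto simp: step_def)
    then have "fires N \<mu> (t # \<sigma>) \<mu>'" by simp
    then show ?case by blast
  qed
qed (auto intro: fires_imp_reachable)

lemma fire_tokens:
  assumes "enabled N \<mu> t"
  shows "fire N \<mu> t p + (if p \<in> preT N t then 1 else 0) = \<mu> p + (if p \<in> postT N t then 1 else 0)"
  using assms by (auto simp: fire_def enabled_def)

lemma fires_tokens:
  assumes "fires N \<mu> \<sigma> \<mu>'"
  shows "\<mu>' p + length (filter (\<lambda>t. p \<in> preT N t) \<sigma>) = \<mu> p + length (filter (\<lambda>t. p \<in> postT N t) \<sigma>)"
  using assms
proof (induction \<sigma> arbitrary: \<mu>)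
  case (Cons t \<sigma>)
  have "enabled N \<mu> t" using Cons.prems by simp
  from fire_tokens[OF this, of p] Cons.IH[of "fire N \<mu> t"] Cons.prems
  show ?case by (auto split: if_splits)
qed simp

lemma fire_sum:
  assumes "finite R" and "enabled N \<mu> t"
  shows "sum (fire N \<mu> t) R + card (preT N t \<inter> R) = sum \<mu> R + card (postT N t \<inter> R)"
proof -
  have ind: "card (S \<inter> R) = (\<Sum>p\<in>R. if p \<in> S then 1 else 0)" for S
    using assms(1) by (simp add: sum.If_cases Int_commute)
  show ?thesis
    unfolding ind sum.distrib[symmetric]
    by (rule sum.cong[OF refl]) (rule fire_tokens[OF assms(2)])
qed

lemma fires_sum:
  assumes "finite R" and "fires N \<mu> \<sigma> \<mu>'"
  shows "sum \<mu>' R + (\<Sum>t\<leftarrow>\<sigma>. card (preT N t \<inter> R)) = sum \<mu> R + (\<Sum>t\<leftarrow>\<sigma>. card (postT N t \<inter> R))"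
  using assms(2)
proof (induction \<sigma> arbitrary: \<mu>)
  case (Cons t \<sigma>)
  have "enabled N \<mu> t" using Cons.prems by simp
  from fire_sum[OF assms(1) this] Cons.IH[of "fire N \<mu> t"] Cons.prems
  show ?case by simp
qed simp

lemma length_filter_mono:
  "(\<And>x. x \<in> set xs \<Longrightarrow> P x \<Longrightarrow> Q x) \<Longrightarrow> length (filter P xs) \<le> length (filter Q xs)"
  by (induction xs) (auto intro: le_SucI)

text \<open>Each firing of \<open>t\<close> puts a token on \<open>p\<close>, only \<open>s\<close>
  takes tokens from \<open>p\<close>, and at most \<open>K\<close> remain. This carries bounds on
  firing counts backwards along arcs.\<close>

lemma fires_count_le:
  assumes "fires N \<mu> \<sigma> \<mu>'" and "\<mu>' p \<le> K" and "p \<in> postT N t"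
    and only: "\<And>t'. t' \<in> set \<sigma> \<Longrightarrow> p \<in> preT N t' \<Longrightarrow> t' = s"
  shows "count_list \<sigma> t \<le> K + count_list \<sigma> s"
proof -
  have "count_list \<sigma> t \<le> length (filter (\<lambda>t. p \<in> postT N t) \<sigma>)"
    unfolding count_list_eq_length_filter using assms(3) by (intro length_filter_mono) auto
  moreover have "length (filter (\<lambda>t. p \<in> preT N t) \<sigma>) \<le> count_list \<sigma> s"
    unfolding count_list_eq_length_filter using only by (intro length_filter_mono) auto
  ultimately show ?thesis
    using fires_tokens[OF assms(1), of p] assms(2) by linarith
qed

lemma fires_marking:
  assumes "is_net N" and "marking N \<mu>" and "fires N \<mu> \<sigma> \<mu>'"
  shows "marking N \<mu>'"
  unfolding marking_def
proof (intro allI impI)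
  fix p assume "p \<notin> places N"
  then have "p \<notin> postT N t" for t
    using assms(1) by (auto simp: is_net_def postT_def)
  then show "\<mu>' p = 0"
    using fires_tokens[OF assms(3), of p] assms(2) \<open>p \<notin> places N\<close> by (simp add: marking_def)
qed

text \<open>Transitions outside \<open>X\<close> never add tokens to \<open>Y\<close>, and those in
  \<open>X\<close> consume from \<open>Y\<close> only. Skipping the former leaves at least as many
  tokens on \<open>Y\<close>, so the latter stay enabled.\<close>

lemma fires_restrict:
  assumes "fires N \<mu> \<sigma> \<mu>'"
    and "\<And>t. t \<in> X \<Longrightarrow> preT N t \<subseteq> Y"
    and "\<And>t. postT N t \<inter> Y \<noteq> {} \<Longrightarrow> t \<in> X"
    and "\<And>p. p \<in> Y \<Longrightarrow> \<mu> p \<le> \<nu> p"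
  shows "\<exists>\<nu>'. fires N \<nu> (filter (\<lambda>t. t \<in> X) \<sigma>) \<nu>'"
  using assms(1,4)
proof (induction \<sigma> arbitrary: \<mu> \<nu>)
  case (Cons t \<sigma>)
  have en: "enabled N \<mu> t" and rest: "fires N (fire N \<mu> t) \<sigma> \<mu>'" using Cons.prems by auto
  show ?case
  proof (cases "t \<in> X")
    case True
    then have en': "enabled N \<nu> t"
      using en Cons.prems(2) assms(2)[OF True] unfolding enabled_def by (meson le_trans subsetD)
    have "fire N \<mu> t p \<le> fire N \<nu> t p" if "p \<in> Y" for p
      using Cons.prems(2)[OF that] by (auto simp: fire_def)
    with Cons.IH[OF rest] en' True show ?thesis by auto
  next
    case False
    then have "fire N \<mu> t p \<le> \<nu> p" if "p \<in> Y" for p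
      using Cons.prems(2)[OF that] assms(3)[of t] that by (auto simp: fire_def)
    with Cons.IH[OF rest] False show ?thesis by auto
  qed
qed (auto intro: exI[of _ \<nu> for \<nu>])

section \<open>Distance in a relation\<close>

text \<open>Unspecified if \<open>y\<close> cannot be reached from \<open>x\<close>; lemmas on a
  general pair therefore assume reachability.\<close>

definition dist :: "('a \<times> 'a) set \<Rightarrow> 'a \<Rightarrow> 'a \<Rightarrow> nat" where
  "dist E x y = (LEAST k. (x, y) \<in> E ^^ k)"

lemma dist_self: "dist E x x = 0"
  unfolding dist_def by (rule Least_equality) auto

lemma dist_relpow: "(x, y) \<in> E\<^sup>* \<Longrightarrow> (x, y) \<in> E ^^ dist E x y"
  unfolding dist_def by (rule LeastI_ex) (rule rtrancl_imp_relpow)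

lemma dist_eq_0: "(x, y) \<in> E\<^sup>* \<Longrightarrow> dist E x y = 0 \<Longrightarrow> x = y"
  using dist_relpow[of x y E] by simp

lemma dist_step:
  assumes "(x, y) \<in> E\<^sup>*" and "x \<noteq> y"
  obtains z where "(x, z) \<in> E" and "(z, y) \<in> E\<^sup>*" and "dist E z y < dist E x y"
proof -
  have xy: "(x, y) \<in> E ^^ dist E x y" using assms(1) by (rule dist_relpow)
  obtain k where k: "dist E x y = Suc k"
    using dist_eq_0[OF assms(1)] assms(2) by (cases "dist E x y") auto
  then have "(x, y) \<in> E ^^ Suc k" using xy by simp
  then obtain z where z: "(x, z) \<in> E" "(z, y) \<in> E ^^ k" by (rule relpow_Suc_E2)
  have "dist E z y \<le> k" unfolding dist_def using z(2) by (rule Least_le)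
  then show thesis using that[of z] z k relpow_imp_rtrancl[OF z(2)] by simp
qed

section \<open>Strong connectedness\<close>

text \<open>Nonemptiness lets strong connectedness provide an output for each place and an input for
  each transition; degenerate nets are treated in the final theorem.\<close>

locale live_bounded_system =
  fixes N :: "('p, 't) net" and \<mu>0 :: "'p \<Rightarrow> nat"
  assumes net: "is_net N" and marking: "marking N \<mu>0"
    and live: "live N \<mu>0" and bounded: "bounded N \<mu>0"
    and nontrivial: "places N \<noteq> {}" "trans N \<noteq> {}"
begin

abbreviation pre :: "'t \<Rightarrow> 'p set" where "pre \<equiv> preT N"
abbreviation post :: "'t \<Rightarrow> 'p set" where "post \<equiv> postT N"

lemma finite_places: "finite (places N)" and finite_trans: "finite (trans N)"
  using net by (auto simp: is_net_def)

lemma preD: "p \<in> pre t \<Longrightarrow> p \<in> places N \<and> t \<in> trans N"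
  using net by (auto simp: is_net_def preT_def)

lemma postD: "p \<in> post t \<Longrightarrow> p \<in> places N \<and> t \<in> trans N"
  using net by (auto simp: is_net_def postT_def)

lemma flow_iff [simp]:
  "(Inl p, Inr t) \<in> flow N \<longleftrightarrow> p \<in> pre t"
  "(Inr t, Inl p) \<in> flow N \<longleftrightarrow> p \<in> post t"
  "(Inl p, Inl q) \<notin> flow N"
  "(Inr t, Inr u) \<notin> flow N"
  by (auto simp: flow_def preT_def postT_def)

lemma reachable_not_place: "reachable N \<mu>0 \<mu> \<Longrightarrow> p \<notin> places N \<Longrightarrow> \<mu> p = 0"
  using fires_marking[OF net marking] unfolding reachable_iff_fires marking_def by blast

lemma reachable_le:
  obtains K where "\<And>\<mu> p. reachable N \<mu>0 \<mu> \<Longrightarrow> \<mu> p \<le> K"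
  using bounded reachable_not_place unfolding bounded_def by (metis zero_le)

lemma fires_often:
  assumes "t \<in> trans N" and "reachable N \<mu>0 \<mu>"
  shows "\<exists>\<sigma> \<mu>'. fires N \<mu> \<sigma> \<mu>' \<and> n \<le> count_list \<sigma> t"
proof (induction n)
  case 0
  have "fires N \<mu> [] \<mu>" by simp
  then show ?case by (meson zero_le)
next
  case (Suc n)
  then obtain \<sigma> \<mu>' where s: "fires N \<mu> \<sigma> \<mu>'" "n \<le> count_list \<sigma> t" by blast
  have "reachable N \<mu>0 \<mu>'" using assms(2) fires_imp_reachable[OF s(1)] by (rule reachable_trans)
  then obtain \<tau> \<nu> where "fires N \<mu>' \<tau> \<nu>" "enabled N \<nu> t"
    using live assms(1) unfolding live_def reachable_iff_fires by blast
  then have "fires N \<mu> (\<sigma> @ \<tau> @ [t]) (fire N \<nu> t)"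
    using s(1) by (auto simp: fires_append)
  moreover have "Suc n \<le> count_list (\<sigma> @ \<tau> @ [t]) t" using s(2) by simp
  ultimately show ?case by blast
qed

text \<open>The part of the net induced by a set closed under predecessors runs autonomously. Skipping
all other transitions, tokens would pile up without bound on any place at an arc leaving the set.\<close>

lemma flow_closed:
  assumes closed: "\<And>x y. (x, y) \<in> flow N \<Longrightarrow> y \<in> Z \<Longrightarrow> x \<in> Z"
    and xy: "(x, y) \<in> flow N" and "x \<in> Z"
  shows "y \<in> Z"
proof (rule ccontr)
  assume "y \<notin> Z"
  define X where "X = {t. Inr t \<in> Z}"
  define Y where "Y = {p. Inl p \<in> Z}"
  have preX: "pre t \<subseteq> Y" if "t \<in> X" for t
    using closed[of "Inl p" "Inr t" for p] that by (auto simp: X_def Y_def)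
  have postY: "t \<in> X" if "post t \<inter> Y \<noteq> {}" for t
    using closed[of "Inr t" "Inl p" for p] that by (auto simp: X_def Y_def)
  obtain K where K: "\<And>\<mu> p. reachable N \<mu>0 \<mu> \<Longrightarrow> \<mu> p \<le> K" by (rule reachable_le) blast
  have run: "\<exists>\<sigma> \<mu> \<nu>. fires N \<mu>0 \<sigma> \<mu> \<and> Suc K \<le> count_list \<sigma> t \<and>
      fires N \<mu>0 (filter (\<lambda>t. t \<in> X) \<sigma>) \<nu>" if "t \<in> trans N" for t
  proof -
    from fires_often[OF that reachable_refl]
    obtain \<sigma> \<mu> where s: "fires N \<mu>0 \<sigma> \<mu>" "Suc K \<le> count_list \<sigma> t" by blast
    with fires_restrict[OF s(1) preX postY, of \<mu>0] show ?thesis by blast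
  qed
  consider (tp) t p where "x = Inr t" "y = Inl p" "p \<in> post t"
    | (pt) p t where "x = Inl p" "y = Inr t" "p \<in> pre t"
    using xy by (cases x; cases y) auto
  then show False
  proof cases
    case tp
    \<comment> \<open>Consumers of \<open>p\<close> lie outside \<open>X\<close>, so in the
      restricted run the tokens that \<open>t\<close> puts on \<open>p\<close> stay there.\<close>
    then have "t \<in> X" "p \<notin> Y" using \<open>x \<in> Z\<close> \<open>y \<notin> Z\<close> by (auto simp: X_def Y_def)
    obtain \<sigma> \<mu> \<nu> where s: "Suc K \<le> count_list \<sigma> t" "fires N \<mu>0 (filter (\<lambda>t. t \<in> X) \<sigma>) \<nu>"
      using run postD[OF tp(3)] by blast
    have "filter (\<lambda>t. p \<in> pre t) (filter (\<lambda>t. t \<in> X) \<sigma>) = []"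
      using preX \<open>p \<notin> Y\<close> by (auto simp: filter_empty_conv)
    then have "length (filter (\<lambda>t. p \<in> post t) (filter (\<lambda>t. t \<in> X) \<sigma>)) \<le> \<nu> p"
      using fires_tokens[OF s(2), of p] by simp
    moreover have "count_list \<sigma> t \<le> length (filter (\<lambda>t. p \<in> post t) (filter (\<lambda>t. t \<in> X) \<sigma>))"
      unfolding count_list_eq_length_filter filter_filter
      using tp(3) \<open>t \<in> X\<close> by (intro length_filter_mono) auto
    ultimately show False
      using s(1) K[OF fires_imp_reachable[OF s(2)], of p] by linarith
  next
    case pt
    then have "p \<in> Y" "t \<notin> X" using \<open>x \<in> Z\<close> \<open>y \<notin> Z\<close> by (auto simp: X_def Y_def)
    obtain \<sigma> \<mu> \<nu> where s: "fires N \<mu>0 \<sigma> \<mu>" "Suc K \<le> count_list \<sigma> t"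
        "fires N \<mu>0 (filter (\<lambda>t. t \<in> X) \<sigma>) \<nu>"
      using run preD[OF pt(3)] by blast
    \<comment> \<open>Producers of \<open>p\<close> survive the restriction, while more than
      \<open>K\<close> firings of its consumer \<open>t\<close> are dropped, so more than
      \<open>K\<close> tokens are left on \<open>p\<close>.\<close>
    have prod: "length (filter (\<lambda>t. p \<in> post t) \<sigma>) \<le>
        length (filter (\<lambda>t. p \<in> post t) (filter (\<lambda>t. t \<in> X) \<sigma>))"
      unfolding filter_filter using postY \<open>p \<in> Y\<close> by (intro length_filter_mono) auto
    have cons: "count_list \<sigma> t + length (filter (\<lambda>t. p \<in> pre t) (filter (\<lambda>t. t \<in> X) \<sigma>)) \<le>
        length (filter (\<lambda>t. p \<in> pre t) \<sigma>)"
      using pt(3) \<open>t \<notin> X\<close> by (induction \<sigma>) auto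
    show False
      using s(2) prod cons fires_tokens[OF s(1), of p] fires_tokens[OF s(3), of p]
        K[OF fires_imp_reachable[OF s(3)], of p] by linarith
  qed
qed

text \<open>The ancestors of \<open>y\<close> are closed under predecessors, hence by
  \<open>flow_closed\<close> under successors; an undirected path from \<open>y\<close> never leaves
  them.\<close>

lemma strongly_connected:
  assumes "x \<in> nodes N" and "y \<in> nodes N"
  shows "(x, y) \<in> (flow N)\<^sup>*"
proof -
  define Z where "Z = {z. (z, y) \<in> (flow N)\<^sup>*}"
  have pred: "u \<in> Z" if "(u, v) \<in> flow N" "v \<in> Z" for u v
    using that by (auto simp: Z_def intro: converse_rtrancl_into_rtrancl)
  have succ: "v \<in> Z" if "(u, v) \<in> flow N" "u \<in> Z" for u v
    using flow_closed[of Z u v] pred that by blast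
  have "(y, x) \<in> (flow N \<union> (flow N)\<inverse>)\<^sup>*"
    using net assms by (auto simp: is_net_def weakly_connected_def)
  then have "x \<in> Z"
    by (induction rule: rtrancl_induct) (auto intro: pred succ simp: Z_def[THEN eqset_imp_iff, of y])
  then show ?thesis by (simp add: Z_def)
qed

lemma post_place_nonempty:
  assumes "p \<in> places N"
  obtains t where "p \<in> pre t"
proof -
  obtain t where "t \<in> trans N" using nontrivial by blast
  then have "(Inl p, Inr t) \<in> (flow N)\<^sup>*"
    using assms by (intro strongly_connected) (auto simp: nodes_def)
  then obtain z where "(Inl p, z) \<in> flow N" by (rule converse_rtranclE) auto
  then show thesis using that by (cases z) auto
qed

lemma pre_nonempty:
  assumes "t \<in> trans N"
  shows "pre t \<noteq> {}"
proof -
  obtain p where "p \<in> places N" using nontrivial by blast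
  then have "(Inl p, Inr t) \<in> (flow N)\<^sup>*"
    using assms by (intro strongly_connected) (auto simp: nodes_def)
  then obtain z where "(z, Inr t) \<in> flow N" by (rule rtranclE) auto
  then show ?thesis by (cases z) auto
qed

definition succT :: "('t \<times> 't) set" where
  "succT = {(t, u). post t \<inter> pre u \<noteq> {}}"

definition succP :: "('p \<times> 'p) set" where
  "succP = {(p, q). \<exists>t. p \<in> pre t \<and> q \<in> post t}"

lemma succT_connected:
  assumes "t \<in> trans N" and "u \<in> trans N"
  shows "(t, u) \<in> succT\<^sup>*"
proof -
  \<comment> \<open>The induction follows single arcs, so the invariant has to cover places as well
    as transitions.\<close>
  have "case x of Inr t \<Rightarrow> (t, u) \<in> succT\<^sup>* | Inl p \<Rightarrow> \<exists>t. p \<in> pre t \<and> (t, u) \<in> succT\<^sup>*"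
    if "(x, Inr u) \<in> (flow N)\<^sup>*" for x
    using that
  proof (induction rule: converse_rtrancl_induct)
    case (step x y)
    then show ?case
      by (cases x; cases y) (auto simp: succT_def intro: converse_rtrancl_into_rtrancl)
  qed simp
  from this[OF strongly_connected[of "Inr t"]] assms show ?thesis by (simp add: nodes_def)
qed

lemma succP_connected:
  assumes "p \<in> places N" and "q \<in> places N"
  shows "(p, q) \<in> succP\<^sup>*"
proof -
  have "case x of Inl q \<Rightarrow> (p, q) \<in> succP\<^sup>* | Inr t \<Rightarrow> \<exists>q. q \<in> pre t \<and> (p, q) \<in> succP\<^sup>*"
    if "(Inl p, x) \<in> (flow N)\<^sup>*" for x
    using that
  proof (induction rule: rtrancl_induct)
    case (step x y)
    then show ?case
      by (cases x; cases y) (auto simp: succP_def intro: rtrancl_into_rtrancl)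
  qed simp
  from this[OF strongly_connected[of _ "Inl q"]] assms show ?thesis by (simp add: nodes_def)
qed

end

section \<open>Covering by P-components\<close>

text \<open>\<open>b\<close> may fail to be injective: counting an entry several times only enlarges
  the upper bound.\<close>

lemma length_filter_le_sum_count:
  assumes "finite R" and "\<And>x. x \<in> set xs \<Longrightarrow> P x \<Longrightarrow> \<exists>r\<in>R. x = b r"
  shows "length (filter P xs) \<le> (\<Sum>r\<in>R. count_list xs (b r))"
  using assms(2)
proof (induction xs)
  case (Cons x xs)
  have IH: "length (filter P xs) \<le> (\<Sum>r\<in>R. count_list xs (b r))"
    using Cons.IH Cons.prems by simp
  have eq: "(\<Sum>r\<in>R. count_list (x # xs) (b r)) =
      (\<Sum>r\<in>R. count_list xs (b r)) + (\<Sum>r\<in>R. if x = b r then 1 else 0)"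
    unfolding sum.distrib[symmetric] by (rule sum.cong) auto
  show ?case
  proof (cases "P x")
    case True
    then obtain r where "r \<in> R" "x = b r" using Cons.prems[of x] by auto
    then have "1 \<le> (\<Sum>r\<in>R. if x = b r then 1 else 0 :: nat)"
      using member_le_sum[of r R "\<lambda>r. if x = b r then 1 else 0 :: nat"] assms(1) by simp
    then show ?thesis unfolding eq using IH True by simp
  next
    case False
    then show ?thesis unfolding eq using IH by simp
  qed
qed simp

locale live_bounded_fc = live_bounded_system N \<mu>0
  for N :: "('p, 't) net" and \<mu>0 :: "'p \<Rightarrow> nat" +
  assumes fc: "free_choice N"
begin

text \<open>This lets a cluster be represented by the common preset of its transitions.\<close>

lemma pre_eq: "p \<in> pre t \<Longrightarrow> p \<in> pre u \<Longrightarrow> pre t = pre u"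
  using fc unfolding free_choice_def preT_def postP_def by blast

lemma enabled_pre_eq: "enabled N \<mu> t \<Longrightarrow> pre u = pre t \<Longrightarrow> u \<in> trans N \<Longrightarrow> enabled N \<mu> u"
  by (simp add: enabled_def)

text \<open>A run enabling \<open>u\<close> exists by liveness. It is cut just before its first
  transition from \<open>Q\<close>; if there is none, \<open>u\<close> itself serves as
  \<open>t\<close>.\<close>

lemma fires_until:
  assumes "reachable N \<mu>0 \<mu>" and "u \<in> trans N" and "u \<in> Q"
  obtains \<sigma> \<mu>' t where "fires N \<mu> \<sigma> \<mu>'" and "set \<sigma> \<inter> Q = {}" and "t \<in> Q" and "enabled N \<mu>' t"
proof -
  obtain \<sigma> \<mu>' where s: "fires N \<mu> \<sigma> \<mu>'" "enabled N \<mu>' u"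
    using live assms(1,2) unfolding live_def reachable_iff_fires by blast
  have "\<exists>\<tau> \<nu> t. fires N \<mu> \<tau> \<nu> \<and> set \<tau> \<inter> Q = {} \<and> t \<in> Q \<and> enabled N \<nu> t"
    using s
  proof (induction \<sigma> arbitrary: \<mu>)
    case Nil
    then have "fires N \<mu> [] \<mu> \<and> set [] \<inter> Q = {} \<and> u \<in> Q \<and> enabled N \<mu> u"
      using assms(3) by simp
    then show ?case by blast
  next
    case (Cons a \<sigma>)
    show ?case
    proof (cases "a \<in> Q")
      case True
      then have "fires N \<mu> [] \<mu> \<and> set [] \<inter> Q = {} \<and> a \<in> Q \<and> enabled N \<mu> a"
        using Cons.prems by simp
      then show ?thesis by blast
    next
      case False
      obtain \<tau> \<nu> t where "fires N (fire N \<mu> a) \<tau> \<nu> \<and> set \<tau> \<inter> Q = {} \<and> t \<in> Q \<and> enabled N \<nu> t"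
        using Cons.IH[of "fire N \<mu> a"] Cons.prems by auto
      then have "fires N \<mu> (a # \<tau>) \<nu> \<and> set (a # \<tau>) \<inter> Q = {} \<and> t \<in> Q \<and> enabled N \<nu> t"
        using Cons.prems False by simp
      then show ?thesis by blast
    qed
  qed
  then show thesis using that by blast
qed

text \<open>The equality conserves the tokens on \<open>R\<close>; the bound makes \<open>R\<close>
  meet each preset, hence each cluster, in at most one place. The empty set qualifies.\<close>

definition p_component :: "'p set \<Rightarrow> bool" where
  "p_component R \<longleftrightarrow>
     R \<subseteq> places N \<and> (\<forall>t. card (pre t \<inter> R) \<le> 1 \<and> card (post t \<inter> R) = card (pre t \<inter> R))"

definition succ_in :: "'p set \<Rightarrow> ('p \<times> 'p) set" where
  "succ_in R = {(q, r). q \<in> R \<and> r \<in> R \<and> (\<exists>t. q \<in> pre t \<and> r \<in> post t)}"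

text \<open>If \<open>u\<close> had two output places in the siphon \<open>R\<close>, resolve all conflicts inside \<open>R\<close> in favour of
transitions that return a token to \<open>R\<close> and lead towards \<open>u\<close>. The number of tokens on \<open>R\<close> then never
decreases and grows whenever \<open>u\<close> fires, so boundedness limits the firings of \<open>u\<close> and, backwards along
the distance to \<open>u\<close>, the firings of all transitions consuming from \<open>R\<close>, against liveness.\<close>

lemma siphon_post_card_le_1:
  assumes R: "R \<subseteq> places N"
    and siphon: "\<And>t. post t \<inter> R \<noteq> {} \<Longrightarrow> pre t \<inter> R \<noteq> {}"
    and uniq: "\<And>t. card (pre t \<inter> R) \<le> 1"
    and conn: "\<And>q r. q \<in> R \<Longrightarrow> r \<in> R \<Longrightarrow> (q, r) \<in> (succ_in R)\<^sup>*"
  shows "card (post u \<inter> R) \<le> 1"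
proof (rule ccontr)
  assume "\<not> card (post u \<inter> R) \<le> 1"
  then have two: "2 \<le> card (post u \<inter> R)" by simp
  have finR: "finite R" using R finite_places finite_subset by blast
  have "post u \<inter> R \<noteq> {}" using two by auto
  then obtain q0 where q0: "q0 \<in> pre u" "q0 \<in> R" using siphon by blast
  define d where "d r = dist (succ_in R) r q0" for r
  \<comment> \<open>At \<open>q0\<close> the selection must be \<open>u\<close>; elsewhere it takes
    a step inside \<open>R\<close> that gets closer to \<open>q0\<close>.\<close>
  have "\<exists>t. r \<in> pre t \<and> post t \<inter> R \<noteq> {} \<and> (r = q0 \<longrightarrow> t = u) \<and>
      (r \<noteq> q0 \<longrightarrow> (\<exists>r'\<in>R \<inter> post t. d r' < d r))" if "r \<in> R" for r
  proof (cases "r = q0")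
    case True
    then show ?thesis using q0 \<open>post u \<inter> R \<noteq> {}\<close> by blast
  next
    case False
    from dist_step[OF conn[OF that q0(2)] False]
    obtain r' where "(r, r') \<in> succ_in R" "d r' < d r" unfolding d_def by blast
    then show ?thesis using False by (auto simp: succ_in_def)
  qed
  then obtain b where b: "\<And>r. r \<in> R \<Longrightarrow> r \<in> pre (b r) \<and> post (b r) \<inter> R \<noteq> {} \<and> (r = q0 \<longrightarrow> b r = u) \<and>
      (r \<noteq> q0 \<longrightarrow> (\<exists>r'\<in>R \<inter> post (b r). d r' < d r))"
    by metis
  define good where "good \<sigma> \<longleftrightarrow> (\<forall>t\<in>set \<sigma>. \<forall>r\<in>R. r \<in> pre t \<longrightarrow> t = b r)" for \<sigma>
  obtain K where K: "\<And>\<mu> p. reachable N \<mu>0 \<mu> \<Longrightarrow> \<mu> p \<le> K" by (rule reachable_le) blast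
  have count_u: "count_list \<sigma> u \<le> card R * K" if "fires N \<mu>0 \<sigma> \<mu>" "good \<sigma>" for \<sigma> \<mu>
  proof -
    \<comment> \<open>A transition of a good run that consumes from \<open>R\<close> takes one token
      and returns at least one; \<open>u\<close> returns at least two.\<close>
    have "(\<Sum>t\<leftarrow>\<sigma>. card (pre t \<inter> R)) + count_list \<sigma> u \<le> (\<Sum>t\<leftarrow>\<sigma>. card (post t \<inter> R))"
      using that(2)
    proof (induction \<sigma>)
      case (Cons t \<sigma>)
      have "card (pre t \<inter> R) + (if t = u then 1 else 0) \<le> card (post t \<inter> R)"
      proof (cases "pre t \<inter> R = {}")
        case True
        then show ?thesis using q0 by auto
      next
        case False
        then obtain r where "r \<in> R" "t = b r" using Cons.prems by (auto simp: good_def)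
        then have "post t \<inter> R \<noteq> {}" using b by simp
        then have "1 \<le> card (post t \<inter> R)" using finR by (simp add: Suc_leI card_gt_0_iff)
        then show ?thesis using uniq[of t] two by auto
      qed
      then show ?case using Cons by (auto simp: good_def)
    qed simp
    moreover have "sum \<mu> R \<le> card R * K"
      using sum_bounded_above[of R \<mu> K] K[OF fires_imp_reachable[OF that(1)]] by simp
    ultimately show ?thesis using fires_sum[OF finR that(1)] by linarith
  qed
  have count_b: "count_list \<sigma> (b r) \<le> card R * K + d r * K"
    if "fires N \<mu>0 \<sigma> \<mu>" "good \<sigma>" "r \<in> R" for \<sigma> \<mu> r
    using that(3)
  proof (induction "d r" arbitrary: r rule: less_induct)
    case less
    show ?case
    proof (cases "r = q0")
      case True
      then show ?thesis using count_u[OF that(1,2)] b[OF less.prems] by simp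
    next
      case False
      then obtain r' where r': "r' \<in> R" "r' \<in> post (b r)" "d r' < d r"
        using b[OF less.prems] by blast
      \<comment> \<open>In a good run only \<open>b r'\<close> can consume the tokens that
        \<open>b r\<close> puts on \<open>r'\<close>.\<close>
      have "count_list \<sigma> (b r) \<le> K + count_list \<sigma> (b r')"
        using that(2) r'(1) K[OF fires_imp_reachable[OF that(1)]]
        by (intro fires_count_le[OF that(1) _ r'(2)]) (auto simp: good_def)
      also have "\<dots> \<le> K + (card R * K + d r' * K)"
        using less.hyps[OF r'(3,1)] by simp
      also have "\<dots> = card R * K + Suc (d r') * K" by simp
      also have "\<dots> \<le> card R * K + d r * K"
        using r'(3) by (intro add_left_mono mult_right_mono) auto
      finally show ?thesis .
    qed
  qed
  have bound: "length (filter (\<lambda>t. pre t \<inter> R \<noteq> {}) \<sigma>) \<le> (\<Sum>r\<in>R. card R * K + d r * K)"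
    if "fires N \<mu>0 \<sigma> \<mu>" "good \<sigma>" for \<sigma> \<mu>
  proof -
    have "length (filter (\<lambda>t. pre t \<inter> R \<noteq> {}) \<sigma>) \<le> (\<Sum>r\<in>R. count_list \<sigma> (b r))"
      using that(2) by (intro length_filter_le_sum_count finR) (auto simp: good_def)
    also have "\<dots> \<le> (\<Sum>r\<in>R. card R * K + d r * K)"
      by (intro sum_mono count_b[OF that])
    finally show ?thesis .
  qed
  \<comment> \<open>Good runs can consume from \<open>R\<close> arbitrarily often: liveness enables
    some consumer, and by free choice the selected transition of its cluster is then enabled
    too.\<close>
  have "\<exists>\<sigma> \<mu>. fires N \<mu>0 \<sigma> \<mu> \<and> good \<sigma> \<and> n \<le> length (filter (\<lambda>t. pre t \<inter> R \<noteq> {}) \<sigma>)" for n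
  proof (induction n)
    case 0
    have "fires N \<mu>0 [] \<mu>0 \<and> good []" by (simp add: good_def)
    then show ?case by blast
  next
    case (Suc n)
    then obtain \<sigma> \<mu> where s: "fires N \<mu>0 \<sigma> \<mu>" "good \<sigma>" "n \<le> length (filter (\<lambda>t. pre t \<inter> R \<noteq> {}) \<sigma>)"
      by blast
    have u: "u \<in> trans N" "u \<in> {t. pre t \<inter> R \<noteq> {}}" using preD q0 by auto
    obtain \<tau> \<nu> t where t: "fires N \<mu> \<tau> \<nu>" "set \<tau> \<inter> {t. pre t \<inter> R \<noteq> {}} = {}"
        "t \<in> {t. pre t \<inter> R \<noteq> {}}" "enabled N \<nu> t"
      by (rule fires_until[OF fires_imp_reachable[OF s(1)] u])
    obtain r where r: "r \<in> R" "r \<in> pre t" using t(3) by blast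
    have rb: "r \<in> pre (b r)" using b[OF r(1)] by simp
    have "enabled N \<nu> (b r)"
      using enabled_pre_eq[OF t(4) pre_eq[OF rb r(2)]] preD[OF rb] by simp
    then have "fires N \<mu>0 (\<sigma> @ \<tau> @ [b r]) (fire N \<nu> (b r))"
      using s(1) t(1) by (auto simp: fires_append)
    moreover have "b r = b r'" if "r' \<in> R" "r' \<in> pre (b r)" for r'
    proof -
      have "card {r, r'} \<le> card (pre (b r) \<inter> R)"
        using that rb r(1) finR by (intro card_mono) auto
      then have "r' = r" using uniq[of "b r"] by (cases "r' = r") auto
      then show ?thesis by simp
    qed
    then have "good (\<sigma> @ \<tau> @ [b r])"
      using s(2) t(2) by (auto simp: good_def)
    moreover have "Suc n \<le> length (filter (\<lambda>t. pre t \<inter> R \<noteq> {}) (\<sigma> @ \<tau> @ [b r]))"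
      using s(3) rb r(1) by auto
    ultimately show ?case by blast
  qed
  then show False using bound by (meson not_less_eq_eq order_trans)
qed

text \<open>By the previous lemma no transition increases the number of tokens on \<open>R\<close>;
  one that decreased it could fire at most \<open>sum \<mu>0 R\<close> times, against
  liveness.\<close>

lemma siphon_p_component:
  assumes R: "R \<subseteq> places N"
    and siphon: "\<And>t. post t \<inter> R \<noteq> {} \<Longrightarrow> pre t \<inter> R \<noteq> {}"
    and uniq: "\<And>t. card (pre t \<inter> R) \<le> 1"
    and conn: "\<And>q r. q \<in> R \<Longrightarrow> r \<in> R \<Longrightarrow> (q, r) \<in> (succ_in R)\<^sup>*"
  shows "p_component R"
proof -
  have finR: "finite R" using R finite_places finite_subset by blast
  have le: "card (post t \<inter> R) \<le> card (pre t \<inter> R)" for t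
  proof (cases "post t \<inter> R = {}")
    case False
    then have "1 \<le> card (pre t \<inter> R)"
      using siphon finR by (simp add: Suc_leI card_gt_0_iff)
    then show ?thesis using siphon_post_card_le_1[OF assms, of t] by linarith
  qed simp
  have "card (post t \<inter> R) = card (pre t \<inter> R)" for t
  proof (rule ccontr)
    assume "card (post t \<inter> R) \<noteq> card (pre t \<inter> R)"
    then have less: "card (post t \<inter> R) < card (pre t \<inter> R)" using le[of t] by simp
    then have "pre t \<inter> R \<noteq> {}" by auto
    then have "t \<in> trans N" using preD by blast
    from fires_often[OF this reachable_refl]
    obtain \<sigma> \<mu> where s: "fires N \<mu>0 \<sigma> \<mu>" "Suc (sum \<mu>0 R) \<le> count_list \<sigma> t" by blast
    have "(\<Sum>t\<leftarrow>\<sigma>. card (post t \<inter> R)) + count_list \<sigma> t \<le> (\<Sum>t\<leftarrow>\<sigma>. card (pre t \<inter> R))"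
    proof (induction \<sigma>)
      case (Cons a \<sigma>)
      then show ?case using le[of a] less by auto
    qed simp
    then show False using fires_sum[OF finR s(1)] s(2) by linarith
  qed
  then show ?thesis using R uniq by (simp add: p_component_def)
qed

text \<open>Keep in every cluster only the place nearest to \<open>p\<close>, measured along directed paths starting
at \<open>p\<close>. The component consists of the kept places met when walking backwards from \<open>p\<close>: it is
strongly connected because nearest places lie on shortest paths from \<open>p\<close>.\<close>

lemma p_component_cover:
  assumes p: "p \<in> places N"
  obtains R where "p_component R" and "p \<in> R"
proof -
  \<comment> \<open>\<open>succP\<close> is reversed because \<open>dist\<close> has its target
    last, while the paths measured here start at \<open>p\<close>.\<close>
  define d where "d q = dist (succP\<inverse>) q p" for q
  define s where "s P = arg_min d (\<lambda>q. q \<in> P)" for P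
  define S where "S = {(r, s (pre t)) | r t. r \<in> post t}"
  define R where "R = {r. (p, r) \<in> S\<^sup>*}"
  have s_in: "s (pre t) \<in> pre t" if "t \<in> trans N" for t
    using pre_nonempty[OF that] unfolding s_def by (metis arg_min_natI ex_in_conv)
  have s_le: "d (s (pre t)) \<le> d q" if "q \<in> pre t" for q t
    unfolding s_def using that by (rule arg_min_nat_le)
  have path: "(q, p) \<in> (succP\<inverse>)\<^sup>*" if "q \<in> places N" for q
    using succP_connected[OF p that] by (simp add: rtrancl_converse)
  have kept: "r \<in> places N \<and> (\<forall>t. r \<in> pre t \<longrightarrow> s (pre t) = r)" if "r \<in> R" for r
    using that unfolding R_def mem_Collect_eq
  proof (induction rule: rtrancl_induct)
    case base
    have "s (pre t) = p" if "p \<in> pre t" for t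
    proof -
      have "d (s (pre t)) = 0" using s_le[OF that] by (simp add: d_def dist_self)
      moreover have "s (pre t) \<in> places N" using s_in preD that by blast
      ultimately show ?thesis using dist_eq_0[OF path] unfolding d_def by blast
    qed
    then show ?case using p by blast
  next
    case (step r r')
    then obtain t where t: "r \<in> post t" "r' = s (pre t)" by (auto simp: S_def)
    then have "r' \<in> pre t" using s_in postD by blast
    then show ?case using preD pre_eq t(2) by metis
  qed
  have kept_pred: "s (pre t) \<in> R" if "r \<in> R" "r \<in> post t" for r t
    using that unfolding R_def S_def by (auto intro: rtrancl_into_rtrancl)
  have pR: "p \<in> R" by (simp add: R_def)
  have edge: "(s (pre t), r) \<in> succ_in R" if "r \<in> R" "r \<in> post t" for r t
    using kept_pred[OF that] that s_in[of t] postD[OF that(2)] by (auto simp: succ_in_def)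
  have to_p: "(r, p) \<in> (succ_in R)\<^sup>*" if "r \<in> R" for r
    using that unfolding R_def mem_Collect_eq
  proof (induction rule: rtrancl_induct)
    case (step r r')
    then obtain t where t: "r \<in> post t" "r' = s (pre t)" by (auto simp: S_def)
    have "r \<in> R" using step.hyps(1) by (simp add: R_def)
    then show ?case using edge[OF _ t(1)] t(2) step.IH
      unfolding R_def by (metis converse_rtrancl_into_rtrancl)
  qed simp
  have from_p: "(p, r) \<in> (succ_in R)\<^sup>*" if "r \<in> R" for r
    using that
  proof (induction "d r" arbitrary: r rule: less_induct)
    case less
    show ?case
    proof (cases "r = p")
      case False
      obtain q where q: "(r, q) \<in> succP\<inverse>" "d q < d r"
        using dist_step[OF path False] kept[OF less.prems] unfolding d_def by blast
      then obtain t where t: "q \<in> pre t" "r \<in> post t" by (auto simp: succP_def)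
      \<comment> \<open>The predecessor \<open>q\<close> on a shortest path may not be kept, but the
        kept place of its cluster also feeds \<open>t\<close> and is no farther from
        \<open>p\<close>.\<close>
      have "d (s (pre t)) < d r" using s_le[OF t(1)] q(2) by simp
      then have "(p, s (pre t)) \<in> (succ_in R)\<^sup>*"
        using less.hyps kept_pred[OF less.prems t(2)] by blast
      then show ?thesis using edge[OF less.prems t(2)] by (rule rtrancl_into_rtrancl)
    qed simp
  qed
  have "p_component R"
  proof (rule siphon_p_component)
    show "R \<subseteq> places N" using kept by blast
    show "pre t \<inter> R \<noteq> {}" if "post t \<inter> R \<noteq> {}" for t
      using that kept_pred s_in postD by blast
    show "card (pre t \<inter> R) \<le> 1" for t
    proof -
      have "pre t \<inter> R \<subseteq> {s (pre t)}" using kept by blast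
      then show ?thesis using card_mono[of "{s (pre t)}"] by simp
    qed
    show "(q, r) \<in> (succ_in R)\<^sup>*" if "q \<in> R" "r \<in> R" for q r
      using to_p[OF that(1)] from_p[OF that(2)] by (rule rtrancl_trans)
  qed
  then show thesis using that pR by blast
qed

end

section \<open>Perpetual free-choice systems\<close>

text \<open>The transition \<open>t0\<close> represents the home cluster, whose places are the inputs of \<open>t0\<close>.\<close>

locale perpetual_fc = live_bounded_fc N \<mu>0
  for N :: "('p, 't) net" and \<mu>0 :: "'p \<Rightarrow> nat" +
  fixes t0 :: 't
  assumes t0: "t0 \<in> trans N"
    and home: "home_marking N \<mu>0 (\<lambda>p. if p \<in> preT N t0 then 1 else 0)"
begin

section \<open>The home marking and the tokens of P-components\<close>

definition h :: "'p \<Rightarrow> nat" where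
  "h p = (if p \<in> pre t0 then 1 else 0)"

lemma h_home: "reachable N \<mu>0 \<mu> \<Longrightarrow> reachable N \<mu> h"
  using home unfolding home_marking_def h_def[abs_def] by blast

lemma h_reachable: "reachable N \<mu>0 h"
  by (rule h_home[OF reachable_refl])

lemma p_component_finite: "p_component R \<Longrightarrow> finite R"
  unfolding p_component_def using finite_places finite_subset by blast

lemma sum_h: "p_component R \<Longrightarrow> sum h R = card (pre t0 \<inter> R)"
  using p_component_finite[of R] by (simp add: h_def sum.If_cases Int_commute)

text \<open>The token count of \<open>R\<close> is invariant. At \<open>h\<close> it is at most 1,
  as \<open>R\<close> meets the inputs of \<open>t0\<close> at most once; it is positive because
  liveness marks \<open>p\<close> at some point.\<close>

lemma p_component_sum:
  assumes R: "p_component R" and "p \<in> R" and "reachable N \<mu>0 \<mu>"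
  shows "sum \<mu> R = 1"
proof -
  have conserve: "sum \<nu> R = sum \<mu>0 R" if "reachable N \<mu>0 \<nu>" for \<nu>
  proof -
    obtain \<sigma> where "fires N \<mu>0 \<sigma> \<nu>" using \<open>reachable N \<mu>0 \<nu>\<close> reachable_iff_fires by blast
    moreover have "(\<lambda>t. card (post t \<inter> R)) = (\<lambda>t. card (pre t \<inter> R))"
      using R by (simp add: p_component_def)
    ultimately show ?thesis using fires_sum[OF p_component_finite[OF R], of N \<mu>0 \<sigma> \<nu>] by simp
  qed
  have "card (pre t0 \<inter> R) \<le> 1" using R by (simp add: p_component_def)
  then have "sum \<mu>0 R \<le> 1" using conserve[OF h_reachable] sum_h[OF R] by simp
  moreover have "1 \<le> sum \<mu>0 R"
  proof -
    have "p \<in> places N" using assms(1,2) by (auto simp: p_component_def)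
    then obtain t where t: "p \<in> pre t" by (rule post_place_nonempty)
    then obtain \<nu> where \<nu>: "reachable N \<mu>0 \<nu>" "enabled N \<nu> t"
      using live preD[OF t] reachable_refl unfolding live_def by blast
    then have "1 \<le> \<nu> p" using t by (auto simp: enabled_def)
    also have "\<dots> \<le> sum \<nu> R" using assms(2) p_component_finite[OF R] by (simp add: member_le_sum)
    finally show ?thesis using conserve[OF \<nu>(1)] by simp
  qed
  ultimately show ?thesis using conserve[OF assms(3)] by simp
qed

lemma p_component_token:
  assumes R: "p_component R" and "p \<in> R" and "reachable N \<mu>0 \<mu>" and "1 \<le> \<mu> p" and "q \<in> R"
  shows "\<mu> q = (if q = p then 1 else 0)"
proof -
  have "\<mu> p + sum \<mu> (R - {p}) = 1"
    using p_component_sum[OF assms(1-3)] sum.remove[OF p_component_finite[OF R] assms(2), of \<mu>]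
    by simp
  then have "\<mu> p = 1" "sum \<mu> (R - {p}) = 0" using assms(4) by auto
  then show ?thesis using p_component_finite[OF R] assms(5) by auto
qed

text \<open>A P-component through a marked place \<open>q\<close> has an input of \<open>t0\<close>.
  That input is marked too, and the component carries a single token, so it is
  \<open>q\<close>.\<close>

lemma enabled_t0_imp_home:
  assumes "reachable N \<mu>0 \<mu>" and "enabled N \<mu> t0"
  shows "\<mu> = h"
proof
  fix q
  show "\<mu> q = h q"
  proof (cases "\<mu> q = 0")
    case True
    then show ?thesis using assms(2) by (auto simp: enabled_def h_def)
  next
    case False
    then have "q \<in> places N" using reachable_not_place[OF assms(1), of q] by auto
    then obtain R where R: "p_component R" "q \<in> R" by (rule p_component_cover)
    have "card (pre t0 \<inter> R) = 1"
      using p_component_sum[OF R h_reachable] sum_h[OF R(1)] by simp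
    then have "pre t0 \<inter> R \<noteq> {}" by auto
    then obtain r where r: "r \<in> pre t0" "r \<in> R" by blast
    have "1 \<le> \<mu> r" using r(1) assms(2) by (simp add: enabled_def)
    from p_component_token[OF R(1) r(2) assms(1) this R(2)] False r(1)
    show ?thesis by (auto simp: h_def split: if_splits)
  qed
qed

text \<open>A partial conflict resolution, with clusters identified by presets. Leaving out the home
  cluster makes selected runs stop at \<open>h\<close>.\<close>

definition allocation :: "'t set \<Rightarrow> bool" where
  "allocation A \<longleftrightarrow> A \<subseteq> trans N \<and> (\<forall>t\<in>A. pre t \<noteq> pre t0) \<and> (\<forall>t\<in>A. \<forall>u\<in>A. pre t = pre u \<longrightarrow> t = u)"

lemma allocation_unique:
  "allocation A \<Longrightarrow> t \<in> A \<Longrightarrow> u \<in> A \<Longrightarrow> p \<in> pre t \<Longrightarrow> p \<in> pre u \<Longrightarrow> t = u"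
  using pre_eq unfolding allocation_def by blast

lemma allocation_h: "allocation A \<Longrightarrow> t \<in> A \<Longrightarrow> p \<in> pre t \<Longrightarrow> h p = 0"
  using pre_eq[of p t t0] unfolding allocation_def h_def by auto

text \<open>Each cluster selects a transition at minimal distance from the home cluster. Firing only
selected transitions outside the home cluster must come to an end, since tokens move towards the
home cluster and would accumulate there.\<close>

lemma pointing_allocation:
  obtains A where "allocation A"
    and "\<And>\<mu>. reachable N \<mu>0 \<mu> \<Longrightarrow> \<exists>\<sigma>. fires N \<mu> \<sigma> h \<and> set \<sigma> \<subseteq> A"
proof -
  define d where "d t = dist succT t t0" for t
  define a where "a P = arg_min d (\<lambda>t. t \<in> trans N \<and> pre t = P)" for P
  define A where "A = {t \<in> trans N. a (pre t) = t \<and> pre t \<noteq> pre t0}"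
  have a: "a (pre t) \<in> trans N \<and> pre (a (pre t)) = pre t \<and> d (a (pre t)) \<le> d t" if "t \<in> trans N" for t
    using arg_min_natI[of "\<lambda>u. u \<in> trans N \<and> pre u = pre t" t d] that
      arg_min_nat_le[of "\<lambda>u. u \<in> trans N \<and> pre u = pre t" t d]
    unfolding a_def by blast
  have aA: "a (pre t) \<in> A" if "t \<in> trans N" "pre t \<noteq> pre t0" for t
    using a[OF that(1)] that by (simp add: A_def)
  have alloc: "allocation A"
    unfolding allocation_def
  proof (intro conjI ballI impI)
    show "t = u" if "t \<in> A" "u \<in> A" "pre t = pre u" for t u
    proof -
      have "t = a (pre t)" using that(1) by (simp add: A_def)
      also have "\<dots> = u" using that(2,3) by (simp add: A_def)
      finally show ?thesis .
    qed
  qed (auto simp: A_def)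
  have t0A: "t0 \<notin> A" by (simp add: A_def)
  obtain K where K: "\<And>\<mu> p. reachable N \<mu>0 \<mu> \<Longrightarrow> \<mu> p \<le> K" by (rule reachable_le) blast
  have count: "count_list \<sigma> t \<le> d t * K"
    if fires: "fires N \<mu> \<sigma> \<nu>" and "reachable N \<mu>0 \<nu>" "set \<sigma> \<subseteq> A" "t \<in> A" for \<mu> \<sigma> \<nu> t
    using that(4)
  proof (induction "d t" arbitrary: t rule: less_induct)
    case less
    have t: "t \<in> trans N" "t \<noteq> t0" using less.prems by (auto simp: A_def)
    obtain u where u: "(t, u) \<in> succT" "d u < d t"
      using dist_step[OF succT_connected[OF t(1) t0] t(2)] unfolding d_def by blast
    then obtain p where p: "p \<in> post t" "p \<in> pre u" by (auto simp: succT_def)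
    have uT: "u \<in> trans N" using preD p(2) by blast
    \<comment> \<open>The only transition that can take tokens from \<open>p\<close> in this run.
      For the home cluster \<open>t0\<close> is a stand-in with count 0, since it is not in
      \<open>A\<close>.\<close>
    define s where "s = (if pre u = pre t0 then t0 else a (pre u))"
    have only: "t' = s" if "t' \<in> set \<sigma>" "p \<in> pre t'" for t'
    proof -
      have "t' \<in> A" "pre t' = pre u"
        using \<open>set \<sigma> \<subseteq> A\<close> that pre_eq[OF that(2) p(2)] by auto
      then show ?thesis by (auto simp: s_def A_def)
    qed
    have "count_list \<sigma> s \<le> d u * K"
    proof (cases "pre u = pre t0")
      case True
      then have "s \<notin> set \<sigma>" using t0A \<open>set \<sigma> \<subseteq> A\<close> by (auto simp: s_def)
      then show ?thesis by (simp add: count_list_0_iff)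
    next
      case False
      then have s: "s \<in> A" "d s \<le> d u" using a[OF uT] aA[OF uT] by (auto simp: s_def)
      then have "count_list \<sigma> s \<le> d s * K" using less.hyps u(2) by simp
      also have "\<dots> \<le> d u * K" using s(2) by simp
      finally show ?thesis .
    qed
    moreover have "count_list \<sigma> t \<le> K + count_list \<sigma> s"
      using fires_count_le[OF fires K[OF \<open>reachable N \<mu>0 \<nu>\<close>] p(1)] only by blast
    ultimately have "count_list \<sigma> t \<le> Suc (d u) * K" by simp
    also have "\<dots> \<le> d t * K" using u(2) by (intro mult_right_mono) auto
    finally show ?case .
  qed
  have finA: "finite A" using finite_trans by (simp add: A_def)
  have "\<exists>\<sigma>. fires N \<mu> \<sigma> h \<and> set \<sigma> \<subseteq> A" if \<mu>: "reachable N \<mu>0 \<mu>" for \<mu>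
  proof -
    define run where "run \<sigma> \<longleftrightarrow> (\<exists>\<nu>. fires N \<mu> \<sigma> \<nu>) \<and> set \<sigma> \<subseteq> A" for \<sigma>
    have len: "length \<sigma> < Suc (\<Sum>t\<in>A. d t * K)" if "run \<sigma>" for \<sigma>
    proof -
      obtain \<nu> where \<nu>: "fires N \<mu> \<sigma> \<nu>" "set \<sigma> \<subseteq> A" using \<open>run \<sigma>\<close> by (auto simp: run_def)
      have "length \<sigma> \<le> (\<Sum>t\<in>A. count_list \<sigma> t)"
        using length_filter_le_sum_count[OF finA, of \<sigma> "\<lambda>_. True" "\<lambda>t. t"] \<nu>(2) by auto
      also have "\<dots> \<le> (\<Sum>t\<in>A. d t * K)"
        using reachable_trans[OF \<mu> fires_imp_reachable[OF \<nu>(1)]] \<nu>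
        by (intro sum_mono count) auto
      finally show ?thesis by simp
    qed
    \<comment> \<open>A longest selected run exists. At its end only the home cluster can be
      enabled, since elsewhere the selected transition would prolong the run.\<close>
    have "run []" by (auto simp: run_def)
    then obtain \<sigma> where "run \<sigma>" and max: "\<And>\<tau>. run \<tau> \<Longrightarrow> length \<tau> \<le> length \<sigma>"
      using ex_has_greatest_nat[of run "[]" length] len by blast
    then obtain \<nu> where \<nu>: "fires N \<mu> \<sigma> \<nu>" "set \<sigma> \<subseteq> A" by (auto simp: run_def)
    have r\<nu>: "reachable N \<mu>0 \<nu>" using \<mu> fires_imp_reachable[OF \<nu>(1)] by (rule reachable_trans)
    \<comment> \<open>With \<open>Q = UNIV\<close> the run is empty, so this says that
      \<open>\<nu>\<close> is not a deadlock.\<close>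
    obtain \<tau> \<xi> t where "fires N \<nu> \<tau> \<xi>" "set \<tau> \<inter> UNIV = {}" and "enabled N \<xi> t"
      by (rule fires_until[OF r\<nu> t0 UNIV_I])
    then have t: "enabled N \<nu> t" by simp
    have "pre t = pre t0"
    proof (rule ccontr)
      assume neq: "pre t \<noteq> pre t0"
      have tT: "t \<in> trans N" using t by (simp add: enabled_def)
      have "enabled N \<nu> (a (pre t))" using enabled_pre_eq[OF t] a[OF tT] by simp
      then have "run (\<sigma> @ [a (pre t)])"
        using \<nu> aA[OF tT neq] by (auto simp: run_def fires_append)
      then show False using max by fastforce
    qed
    then have "enabled N \<nu> t0" using enabled_pre_eq[OF t _ t0] by simp
    then have "\<nu> = h" by (rule enabled_t0_imp_home[OF r\<nu>])
    then show ?thesis using \<nu> by blast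
  qed
  then show thesis using that alloc by blast
qed

text \<open>Under an allocation the single token of a P-component moves deterministically until it reaches
the home cluster.\<close>

lemma allocation_component_length:
  assumes A: "allocation A" and R: "p_component R"
    and "reachable N \<mu>0 \<mu>" and "reachable N \<mu>0 \<nu>" and "\<And>q. q \<in> R \<Longrightarrow> \<mu> q = \<nu> q"
    and "fires N \<mu> \<sigma> h" and "set \<sigma> \<subseteq> A" and "fires N \<nu> \<tau> h" and "set \<tau> \<subseteq> A"
  shows "length (filter (\<lambda>t. pre t \<inter> R \<noteq> {}) \<sigma>) = length (filter (\<lambda>t. pre t \<inter> R \<noteq> {}) \<tau>)"
  using assms(3-)
proof (induction "length \<sigma> + length \<tau>" arbitrary: \<mu> \<nu> \<sigma> \<tau> rule: less_induct)
  case less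
  note reach = less.prems(1,2) and agree = less.prems(3)
  have skip: "fire N \<xi> t q = \<xi> q" if "pre t \<inter> R = {}" "q \<in> R" for \<xi> t q
  proof -
    have "card (post t \<inter> R) = 0" using R that(1) by (simp add: p_component_def)
    then have "post t \<inter> R = {}" using p_component_finite[OF R] by simp
    then show ?thesis using that by (auto simp: fire_def)
  qed
  have step: "enabled N \<xi> t \<Longrightarrow> reachable N \<mu>0 \<xi> \<Longrightarrow> reachable N \<mu>0 (fire N \<xi> t)" for \<xi> t
    by (rule reachable_trans[OF _ reachable_fire])
  \<comment> \<open>Once \<open>R\<close> is marked as in \<open>h\<close>, no selected transition
    can consume from it, because \<open>h\<close> vanishes on its inputs.\<close>
  have blocked: False if "fires N \<xi> (t # \<rho>) h" "t \<in> A" "pre t \<inter> R \<noteq> {}" "\<And>q. q \<in> R \<Longrightarrow> \<xi> q = h q"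
    for \<xi> t \<rho>
  proof -
    obtain q where "q \<in> pre t" "q \<in> R" using \<open>pre t \<inter> R \<noteq> {}\<close> by blast
    moreover from this have "1 \<le> \<xi> q" using that(1) by (simp add: enabled_def)
    ultimately show False using allocation_h[OF A that(2)] that(4) by fastforce
  qed
  \<comment> \<open>Heads not consuming from \<open>R\<close> are dropped first. Of the rest, a lone
    head is blocked, and two heads consume the same token and therefore coincide.\<close>
  consider (skip1) t \<sigma>' where "\<sigma> = t # \<sigma>'" "pre t \<inter> R = {}"
    | (skip2) t \<tau>' where "\<tau> = t # \<tau>'" "pre t \<inter> R = {}"
    | (nil) "\<sigma> = []" "\<tau> = []"
    | (nil1) t \<tau>' where "\<sigma> = []" "\<tau> = t # \<tau>'" "pre t \<inter> R \<noteq> {}"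
    | (nil2) t \<sigma>' where "\<tau> = []" "\<sigma> = t # \<sigma>'" "pre t \<inter> R \<noteq> {}"
    | (both) t \<sigma>' u \<tau>' where "\<sigma> = t # \<sigma>'" "\<tau> = u # \<tau>'" "pre t \<inter> R \<noteq> {}" "pre u \<inter> R \<noteq> {}"
    by (metis list.exhaust)
  then show ?case
  proof cases
    case skip1
    then show ?thesis
      using less.hyps[of \<sigma>' \<tau> "fire N \<mu> t" \<nu>] less.prems step skip by auto
  next
    case skip2
    then show ?thesis
      using less.hyps[of \<sigma> \<tau>' \<mu> "fire N \<nu> t"] less.prems step skip by auto
  next
    case nil
    then show ?thesis by simp
  next
    case nil1
    then have "\<mu> = h" using less.prems(4) by simp
    then show ?thesis using blocked[of \<nu> t \<tau>'] nil1 less.prems(6,7) agree by auto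
  next
    case nil2
    then have "\<nu> = h" using less.prems(6) by simp
    then show ?thesis using blocked[of \<mu> t \<sigma>'] nil2 less.prems(4,5) agree by auto
  next
    case both
    obtain q where q: "q \<in> pre t" "q \<in> R" using both(3) by blast
    obtain r where r: "r \<in> pre u" "r \<in> R" using both(4) by blast
    have en: "enabled N \<mu> t" "enabled N \<nu> u" using less.prems(4,6) both by auto
    have "1 \<le> \<nu> q" using en(1) q(1) agree[OF q(2)] by (auto simp: enabled_def)
    moreover have "1 \<le> \<nu> r" using en(2) r by (simp add: enabled_def)
    ultimately have "q = r"
      using p_component_token[OF R q(2) reach(2) _ r(2)] by (auto split: if_splits)
    then have "t = u"
      using allocation_unique[OF A _ _ q(1)] r(1) less.prems(5,7) both(1,2) by auto
    then have "fire N \<mu> t p = fire N \<nu> u p" if "p \<in> R" for p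
      using agree[OF that] by (simp add: fire_def)
    then show ?thesis
      using less.hyps[of \<sigma>' \<tau>' "fire N \<mu> t" "fire N \<nu> u"] less.prems step en both by auto
  qed
qed

text \<open>If \<open>t\<close> fired twice, a P-component through one of its inputs would be marked
  alike both times. The two remaining runs would then consume from it equally often, but the longer
  one does so at least once more.\<close>

lemma allocation_distinct:
  assumes A: "allocation A"
    and "reachable N \<mu>0 \<mu>" and "fires N \<mu> \<sigma> h" and "set \<sigma> \<subseteq> A"
  shows "distinct \<sigma>"
  using assms(2-)
proof (induction \<sigma> arbitrary: \<mu>)
  case (Cons t \<sigma>)
  have en: "enabled N \<mu> t" and rest: "fires N (fire N \<mu> t) \<sigma> h" using Cons.prems by auto
  have reach: "reachable N \<mu>0 (fire N \<mu> t)"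
    using Cons.prems(1) reachable_fire[OF en] by (rule reachable_trans)
  have "t \<notin> set \<sigma>"
  proof
    assume "t \<in> set \<sigma>"
    then obtain u v where \<sigma>: "\<sigma> = u @ t # v" by (meson split_list)
    then obtain \<nu> where \<nu>: "fires N (fire N \<mu> t) u \<nu>" "fires N \<nu> (t # v) h"
      using rest by (auto simp: fires_append)
    have r\<nu>: "reachable N \<mu>0 \<nu>" using reach fires_imp_reachable[OF \<nu>(1)] by (rule reachable_trans)
    obtain p where p: "p \<in> pre t" using pre_nonempty en unfolding enabled_def by blast
    then obtain R where R: "p_component R" "p \<in> R" using p_component_cover preD by blast
    have "1 \<le> \<mu> p" "1 \<le> \<nu> p" using en \<nu>(2) p by (auto simp: enabled_def)
    then have agree: "\<mu> q = \<nu> q" if "q \<in> R" for q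
      using p_component_token[OF R Cons.prems(1) _ that] p_component_token[OF R r\<nu> _ that] by simp
    have "set (t # v) \<subseteq> A" using Cons.prems(3) \<sigma> by auto
    from allocation_component_length[OF A R(1) Cons.prems(1) r\<nu> agree Cons.prems(2,3) \<nu>(2) this]
    have "length (filter (\<lambda>t. pre t \<inter> R \<noteq> {}) (t # u @ t # v)) = length (filter (\<lambda>t. pre t \<inter> R \<noteq> {}) (t # v))"
      unfolding \<sigma> .
    moreover have "pre t \<inter> R \<noteq> {}" using p R(2) by blast
    ultimately show False by simp
  qed
  then show ?case using Cons.IH[OF reach rest] Cons.prems(3) by simp
qed simp

text \<open>A token that ever lies on \<open>p\<close> must be gone at \<open>h\<close>, and only
  \<open>t\<close> among the selected transitions can remove it.\<close>

lemma allocation_consumes: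
  assumes A: "allocation A" and "fires N \<nu> \<tau> h" and "set \<tau> \<subseteq> A" and "t \<in> A" and "p \<in> pre t"
    and "1 \<le> \<nu> p \<or> (\<exists>u\<in>set \<tau>. p \<in> post u)"
  shows "t \<in> set \<tau>"
proof -
  have "1 \<le> \<nu> p + length (filter (\<lambda>u. p \<in> post u) \<tau>)"
    using assms(6) by (auto simp: Suc_le_eq filter_empty_conv)
  then have "filter (\<lambda>u. p \<in> pre u) \<tau> \<noteq> []"
    using fires_tokens[OF assms(2), of p] allocation_h[OF A assms(4,5)] by auto
  then obtain u where "u \<in> set \<tau>" "p \<in> pre u" by (auto simp: filter_empty_conv)
  then show ?thesis using allocation_unique[OF A assms(4) _ assms(5)] assms(3) by blast
qed

text \<open>Induction along \<open>\<sigma>\<close>: a transition fired is either enabled at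
  \<open>\<mu>\<close>, hence at \<open>\<nu>\<close>, or some input got a token from an earlier
  transition, which by induction occurs in \<open>\<tau>\<close>.\<close>

lemma allocation_set_subset:
  assumes A: "allocation A" and "en N \<mu> \<subseteq> en N \<nu>"
    and \<tau>: "fires N \<nu> \<tau> h" "set \<tau> \<subseteq> A"
    and "fires N \<mu> \<sigma> \<xi>" and "set \<sigma> \<subseteq> A"
  shows "set \<sigma> \<subseteq> set \<tau>"
  using assms(5,6)
proof (induction \<sigma> arbitrary: \<xi> rule: rev_induct)
  case (snoc t \<sigma>)
  then obtain \<xi>' where \<xi>': "fires N \<mu> \<sigma> \<xi>'" "enabled N \<xi>' t" by (auto simp: fires_append)
  have IH: "set \<sigma> \<subseteq> set \<tau>" using snoc.IH[OF \<xi>'(1)] snoc.prems(2) by simp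
  have tA: "t \<in> A" using snoc.prems(2) by simp
  have tT: "t \<in> trans N" using \<xi>'(2) by (simp add: enabled_def)
  have "\<exists>p\<in>pre t. 1 \<le> \<nu> p \<or> (\<exists>u\<in>set \<tau>. p \<in> post u)"
  proof (cases "enabled N \<mu> t")
    case True
    then have "enabled N \<nu> t" using assms(2) by (auto simp: en_def)
    then show ?thesis using pre_nonempty[OF tT] by (auto simp: enabled_def)
  next
    case False
    then obtain p where p: "p \<in> pre t" "\<mu> p = 0" using tT by (auto simp: enabled_def not_le)
    have "1 \<le> \<xi>' p" using \<xi>'(2) p(1) by (simp add: enabled_def)
    then have "filter (\<lambda>u. p \<in> post u) \<sigma> \<noteq> []"
      using fires_tokens[OF \<xi>'(1), of p] p(2) by auto
    then show ?thesis using IH p(1) by (auto simp: filter_empty_conv)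
  qed
  then have "t \<in> set \<tau>" using allocation_consumes[OF A \<tau> tA] by blast
  then show ?case using IH by simp
qed simp

lemma lucent: "lucent N \<mu>0"
  unfolding lucent_def
proof (intro allI impI)
  fix \<mu> \<nu>
  assume \<mu>: "reachable N \<mu>0 \<mu>" and \<nu>: "reachable N \<mu>0 \<nu>" and en: "en N \<mu> = en N \<nu>"
  obtain A where A: "allocation A"
    and run: "\<And>\<mu>. reachable N \<mu>0 \<mu> \<Longrightarrow> \<exists>\<sigma>. fires N \<mu> \<sigma> h \<and> set \<sigma> \<subseteq> A"
    by (rule pointing_allocation) blast
  obtain \<sigma> where \<sigma>: "fires N \<mu> \<sigma> h" "set \<sigma> \<subseteq> A" using run[OF \<mu>] by blast
  obtain \<tau> where \<tau>: "fires N \<nu> \<tau> h" "set \<tau> \<subseteq> A" using run[OF \<nu>] by blast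
  have "set \<sigma> = set \<tau>"
    using allocation_set_subset[OF A _ \<tau> \<sigma>] allocation_set_subset[OF A _ \<sigma> \<tau>] en by blast
  moreover have "distinct \<sigma>" "distinct \<tau>"
    using allocation_distinct[OF A] \<mu> \<nu> \<sigma> \<tau> by blast+
  \<comment> \<open>Distinct lists with equal sets fire every transition equally often, so the
    marking equation can be solved backwards from \<open>h\<close>.\<close>
  ultimately have "length (filter P \<sigma>) = length (filter P \<tau>)" for P
    by (metis distinct_card distinct_filter set_filter)
  then show "\<mu> = \<nu>"
    using fires_tokens[OF \<sigma>(1)] fires_tokens[OF \<tau>(1)] by (metis add_right_cancel ext)
qed

end

section \<open>Degenerate nets and a transition representing the home cluster\<close>

theorem theorem8p1:
  fixes N :: "('p, 't) net" and \<mu>0 :: "'p \<Rightarrow> nat"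
  assumes "free_choice_system N \<mu>0"
    and "perpetual N \<mu>0"
  shows "lucent N \<mu>0"
proof -
  have fc: "free_choice N" and marking: "marking N \<mu>0"
    using assms(1) by (auto simp: free_choice_system_def)
  then have net: "is_net N" by (simp add: free_choice_def)
  consider (noT) "trans N = {}" | (noP) "places N = {}" | (both) "places N \<noteq> {}" "trans N \<noteq> {}"
    by blast
  then show ?thesis
  proof cases
    case noT
    then have "step N = {}" by (auto simp: step_def enabled_def)
    then show ?thesis by (simp add: lucent_def reachable_def)
  next
    case noP
    have "\<mu> = (\<lambda>_. 0)" if "reachable N \<mu>0 \<mu>" for \<mu>
      using fires_marking[OF net marking] that noP
      unfolding reachable_iff_fires marking_def by auto
    then show ?thesis by (auto simp: lucent_def)
  next
    case both
    interpret live_bounded_fc N \<mu>0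
      using fc marking net assms(2) both by unfold_locales (auto simp: perpetual_def)
    obtain x where x: "x \<in> nodes N" and home: "home_marking N \<mu>0 (cluster_marking (cluster N x))"
      using assms(2) by (auto simp: perpetual_def is_cluster_def)
    obtain t0 where t0: "t0 \<in> trans N" "Inr t0 \<in> cluster N x"
      and x_t0: "x = Inr t0 \<or> (\<exists>p\<in>pre t0. x = Inl p)"
    proof (cases x)
      case (Inl p)
      then have "p \<in> places N" using x by (auto simp: nodes_def)
      then obtain t where t: "p \<in> pre t" by (rule post_place_nonempty)
      then have "Inr t \<in> cluster N x"
        using Inl by (intro cluster.place_post[of p]) (auto simp: cluster.base postP_def preT_def)
      then show thesis using that[of t] preD[OF t] t Inl by blast
    next
      case (Inr t)
      then show thesis using that[of t] x cluster.base[of x N] by (auto simp: nodes_def)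
    qed
    \<comment> \<open>By free choice all transitions of the cluster share the preset of
      \<open>t0\<close>, so its places are exactly the inputs of \<open>t0\<close>.\<close>
    have "case y of Inl p \<Rightarrow> p \<in> pre t0 | Inr t \<Rightarrow> pre t = pre t0" if "y \<in> cluster N x" for y
      using that
    proof induction
      case base
      then show ?case using x_t0 by auto
    next
      case (place_post p t)
      then show ?case using pre_eq[of p t t0] by (auto simp: postP_def preT_def)
    next
      case (trans_pre t p)
      then show ?case by simp
    qed
    from this[of "Inl p" for p] have "Inl p \<in> cluster N x \<longleftrightarrow> p \<in> pre t0" for p
      using cluster.trans_pre[OF t0(2)] by auto
    then have "cluster_marking (cluster N x) = (\<lambda>p. if p \<in> pre t0 then 1 else 0)"
      by (simp add: cluster_marking_def)
    then interpret perpetual_fc N \<mu>0 t0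
      using t0(1) home by unfold_locales auto
    show ?thesis by (rule lucent)
  qed
qed

end
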